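(* For any $N$ and any $\sigma,\tau\in\mathcal{P}(k)$, the sign of $\mathring{\mathrm{Wg}}_k(\sigma,\tau,N)$ is $(-1)^{\#\sigma+\#\tau}$.
   Context: $\mathcal{P}(k)$ is the lattice of set partitions of $[k]=\{1,\dots,k\}$, ordered by refinement: $\pi_1\le\pi_2$ iff every block of $\pi_1$ is contained in a block of $\pi_2$; $\wedge$ and $\vee$ are the greatest lower bound (meet) and least upper bound (join). $\#\pi$ is the number of blocks of $\pi$, and $D(\pi)=\{j\in[k]:\{j\}\text{ is a block of }\pi\}$. For $\pi_1\le\pi_2$, if the blocks $B_1,\dots,B_r$ of $\pi_2$ are split into $\lambda_1,\dots,\lambda_r$ blocks of $\pi_1$ respectively, then $\mu(\pi_1,\pi_2)=\prod_{i=1}^{r}(-1)^{\lambda_i-1}(\lambda_i-1)!$ (the Möbius function of $\mathcal{P}(k)$). $(x)_n=x(x-1)\cdots(x-n+1)$ is the falling factorial, with $(x)_0=1$. The centered Weingarten function of the symmetric group $S_N$ is $$\mathring{\mathrm{Wg}}_k(\sigma,\tau,N)=\sum_{i=0}^{|D(\sigma\vee\tau)|}\binom{|D(\sigma\vee\tau)|}{i}(-1)^i\sum_{\pi\in\mathcal{P}(k),\ \pi\le\sigma\wedge\tau}\mu(\pi,\sigma)\,\mu(\pi,\tau)\,N^{-i}\,\frac{1}{(N)_{\#\pi-i}}.$$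
   Formalization: The claim is proved for integers N ≥ k, since the formula contains 1/(N)_k and is undefined for N < k; for k = 1 the function is identically 0 (1/N − 1/N), so there the value 0 is stated in place of the sign. *)

theory Defs
  imports Complex_Main "HOL-Library.Disjoint_Sets" "HOL-Algebra.Lattice"
begin

text \<open>The set partitions of \<open>{1..k}\<close> ordered by refinement; \<open>\<sqinter>\<close> and \<open>\<squnion>\<close> below are the
  greatest lower bound and the least upper bound of the library, taken in this order.\<close>

definition partition_lattice :: "nat \<Rightarrow> nat set set gorder" where
  "partition_lattice k =
     \<lparr>carrier = {\<pi>. partition_on {1..k} \<pi>}, eq = (=), le = refines {1..k}\<rparr>"

lemma partition_lattice_simps [simp]:
  "\<pi> \<in> carrier (partition_lattice k) \<longleftrightarrow> partition_on {1..k} \<pi>"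
  "le (partition_lattice k) = refines {1..k}"
  "eq (partition_lattice k) = (=)"
  by (simp_all add: partition_lattice_def)

lemma lattice_partition_lattice: "lattice (partition_lattice k)"
proof -
  let ?L = "partition_lattice k" and ?A = "{1..k}"
  have "partial_order ?L"
  proof (unfold_locales, goal_cases)
    case (5 x y)
    then show ?case using refines_asym by simp
  next
    case (6 x y z)
    then show ?case using refines_trans by (metis partition_lattice_simps(2))
  qed (simp_all add: refines_refl)
  moreover have "\<exists>s. greatest ?L s (Lower ?L {P, Q})"
    if P: "partition_on ?A P" and Q: "partition_on ?A Q" for P Q
  proof
    let ?M = "common_refinement {P, Q}"
    have part: "partition_on ?A R" if "R \<in> {P, Q}" for R
      using that P Q by blast
    have "partition_on ?A ?M" "refines ?A ?M P" "refines ?A ?M Q"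
      using partition_on_common_refinement[OF part] refines_common_refinement[OF part] by blast+
    moreover have "refines ?A R ?M" if "refines ?A R P" "refines ?A R Q" for R
    proof (rule common_refinement_coarsest[OF part])
      show "partition_on ?A R"
        using that(1) unfolding refines_def by blast
    qed (use that in blast)+
    ultimately show "greatest ?L ?M (Lower ?L {P, Q})"
      using P Q unfolding greatest_def Lower_def subset_iff Int_iff mem_Collect_eq
        insert_iff partition_lattice_simps by blast
  qed
  moreover have "\<exists>s. least ?L s (Upper ?L {P, Q})"
    if P: "partition_on ?A P" and Q: "partition_on ?A Q" for P Q
  proof
    let ?U = "{R. refines ?A P R \<and> refines ?A Q R}"
    let ?J = "common_refinement ?U"
    have part: "partition_on ?A R" if "R \<in> ?U" for R
      using that unfolding refines_def by blast
    have top: "partition_on ?A ({?A} - {{}})"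
      by (auto simp: partition_on_def disjoint_def)
    have "refines ?A R ({?A} - {{}})" if R: "partition_on ?A R" for R
    proof -
      have "X \<subseteq> ?A \<and> ?A \<noteq> {}" if "X \<in> R" for X
        using partition_onD1[OF R] partition_onD3[OF R] that by (metis Sup_upper subset_empty)
      then show ?thesis
        using R top unfolding refines_def by (metis DiffI insertI1 singletonD)
    qed
    then have ne: "?U \<noteq> {}"
      using P Q by blast
    have "partition_on ?A ?J" "\<And>R. R \<in> ?U \<Longrightarrow> refines ?A ?J R"
      using partition_on_common_refinement[OF part ne] refines_common_refinement[OF part]
      by blast+
    moreover have "refines ?A P ?J" "refines ?A Q ?J"
      using common_refinement_coarsest[OF part P _ ne] common_refinement_coarsest[OF part Q _ ne]
      by blast+
    ultimately show "least ?L ?J (Upper ?L {P, Q})"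
      using P Q unfolding least_def Upper_def subset_iff Int_iff mem_Collect_eq
        insert_iff partition_lattice_simps by blast
  qed
  ultimately show ?thesis
    by (simp add: lattice_def upper_semilattice_def lower_semilattice_def
        upper_semilattice_axioms_def lower_semilattice_axioms_def)
qed

definition singleton_points :: "nat \<Rightarrow> nat set set \<Rightarrow> nat set" where
  "singleton_points k \<pi> = {j \<in> {1..k}. {j} \<in> \<pi>}"

text \<open>Only meaningful when \<open>\<pi>\<^sub>1\<close> refines \<open>\<pi>\<^sub>2\<close>; the truncated subtraction is then harmless, since
  every block of \<open>\<pi>\<^sub>2\<close> contains at least one block of \<open>\<pi>\<^sub>1\<close>.\<close>

definition partition_moebius :: "nat set set \<Rightarrow> nat set set \<Rightarrow> real" where
  "partition_moebius \<pi>\<^sub>1 \<pi>\<^sub>2 =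
     (\<Prod>B\<in>\<pi>\<^sub>2. let l = card {A \<in> \<pi>\<^sub>1. A \<subseteq> B} in (-1) ^ (l - 1) * fact (l - 1))"

definition falling_factorial :: "real \<Rightarrow> nat \<Rightarrow> real" where
  "falling_factorial x n = (\<Prod>j<n. x - real j)"

text \<open>The index \<open>card \<pi> - i\<close> never truncates: a singleton block of \<open>\<sigma> \<squnion> \<tau>\<close> is a singleton block of
  every \<open>\<pi>\<close> below \<open>\<sigma> \<sqinter> \<tau>\<close>, so \<open>i \<le> card \<pi>\<close>. The term \<open>i = 0\<close> with \<open>\<pi>\<close> the finest partition
  is \<open>1 / (N)\<^sub>k\<close>, so the formula involves no division by zero precisely when \<open>k \<le> N\<close>.\<close>

definition centered_Wg :: "nat \<Rightarrow> nat set set \<Rightarrow> nat set set \<Rightarrow> nat \<Rightarrow> real" where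
  "centered_Wg k \<sigma> \<tau> N =
     (let L = partition_lattice k;
          d = card (singleton_points k (\<sigma> \<squnion>\<^bsub>L\<^esub> \<tau>))
      in \<Sum>i=0..d. real (d choose i) * (-1) ^ i *
           (\<Sum>\<pi> | \<pi> \<in> carrier L \<and> \<pi> \<sqsubseteq>\<^bsub>L\<^esub> \<sigma> \<sqinter>\<^bsub>L\<^esub> \<tau>.
              partition_moebius \<pi> \<sigma> * partition_moebius \<pi> \<tau> * inverse (real N ^ i) *
              (1 / falling_factorial (real N) (card \<pi> - i))))"

end

theory Submission
  imports Defs
begin

text \<open>
  Below \<open>\<sigma> \<sqinter> \<tau>\<close> the product \<open>\<mu>(\<pi>, \<sigma>) \<mu>(\<pi>, \<tau>)\<close> has the sign \<open>(-1)\<^bsup>#\<sigma> + #\<tau>\<^esup>\<close> whatever \<open>\<pi>\<close> is, since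
  \<open>\<mu>(\<pi>, \<sigma>)\<close> has the sign \<open>(-1)\<^bsup>#\<pi> - #\<sigma>\<^esup>\<close> (\<open>partition_moebius_sign\<close>). After exchanging the two sums
  of \<open>centered_Wg\<close>, the factor that multiplies this product is
  \<open>\<Sum>\<^sub>i (d choose i) (-1)\<^sup>i N\<^bsup>-i\<^esup> / (N)\<^bsub>n - i\<^esub>\<close> with \<open>n = #\<pi>\<close> and \<open>d = |D(\<sigma> \<squnion> \<tau>)|\<close>. Multiplied by
  \<open>N\<^sup>n\<close>, it is the \<open>d\<close>-th forward difference at \<open>n - d\<close> of the sequence \<open>h(m) = N\<^sup>m / (N)\<^sub>m\<close>.

  So the whole theorem rests on the signs of the differences of \<open>h\<close>. From
  \<open>h(m + 1) = h(m) N / (N - m)\<close> one gets \<open>(N - m) \<Delta>h(m) = m h(m)\<close>, and taking differences of this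
  equation yields
  \<open>(N - m) \<Delta>\<^bsup>d+1\<^esup>h(m) = m \<Delta>\<^sup>dh(m) + d \<Delta>\<^bsup>d-1\<^esup>h(m + 2)\<close>,
  in which all coefficients are nonnegative (\<open>power_falling_ratio_difference_rec\<close>). By induction all
  differences within the range \<open>0, \<dots>, N\<close> are nonnegative, and the only one that vanishes is
  \<open>\<Delta>h(0) = h(1) - h(0)\<close>.

  Hence no term has the wrong sign. The finest partition, with \<open>n = k\<close>, always occurs in the sum, and
  its term vanishes only if \<open>d = 1\<close> and \<open>k - d = 0\<close>, that is, only if \<open>k = 1\<close>.
\<close>

section \<open>Differences of the ratio of powers to falling factorials\<close>

definition forward_difference :: "(nat \<Rightarrow> 'a::comm_ring_1) \<Rightarrow> nat \<Rightarrow> 'a" where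
  "forward_difference f m = f (Suc m) - f m"

lemma iterated_difference_Suc:
  "(forward_difference ^^ Suc d) f m
     = (forward_difference ^^ d) f (Suc m) - (forward_difference ^^ d) f m"
  by (simp add: forward_difference_def)

lemma iterated_difference_binomial:
  "(forward_difference ^^ d) f m = (\<Sum>i\<le>d. of_nat (d choose i) * (-1) ^ i * f (m + d - i))"
proof (induction d arbitrary: m)
  case 0
  then show ?case by simp
next
  case (Suc d)
  define c where "c i = (-1) ^ i * f (m + Suc d - i)" for i
  have "(\<Sum>i\<le>Suc d. of_nat (Suc d choose i) * (-1) ^ i * f (m + Suc d - i))
      = c 0 + (\<Sum>i\<le>d. of_nat (Suc d choose Suc i) * c (Suc i))"
    by (simp add: sum.atMost_Suc_shift mult.assoc c_def del: sum.atMost_Suc binomial_Suc_Suc)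
  also have "\<dots> = (c 0 + (\<Sum>i\<le>d. of_nat (d choose Suc i) * c (Suc i)))
                + (\<Sum>i\<le>d. of_nat (d choose i) * c (Suc i))"
    by (simp add: sum.distrib algebra_simps)
  also have "c 0 + (\<Sum>i\<le>d. of_nat (d choose Suc i) * c (Suc i))
      = (\<Sum>i\<le>Suc d. of_nat (d choose i) * c i)"
    by (simp add: sum.atMost_Suc_shift del: sum.atMost_Suc)
  also have "\<dots> = (forward_difference ^^ d) f (Suc m)"
    by (simp add: Suc.IH c_def mult.assoc binomial_eq_0)
  also have "(\<Sum>i\<le>d. of_nat (d choose i) * c (Suc i)) = - (forward_difference ^^ d) f m"
    by (simp add: Suc.IH c_def mult.assoc sum_negf)
  finally show ?case
    unfolding iterated_difference_Suc by simp
qed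

definition power_falling_ratio :: "nat \<Rightarrow> nat \<Rightarrow> real" where
  "power_falling_ratio N m = real N ^ m / falling_factorial (real N) m"

lemma falling_factorial_pos: "m \<le> N \<Longrightarrow> falling_factorial (real N) m > 0"
  unfolding falling_factorial_def by (rule prod_pos) auto

lemma power_falling_ratio_pos:
  assumes "m \<le> N"
  shows "power_falling_ratio N m > 0"
proof -
  have "real N ^ m > 0"
    using assms by (cases "N = 0") auto
  then show ?thesis
    using falling_factorial_pos[OF assms] by (simp add: power_falling_ratio_def)
qed

lemma power_falling_ratio_Suc:
  assumes "m < N"
  shows "(real N - real m) * power_falling_ratio N (Suc m) = real N * power_falling_ratio N m"
proof -
  have "falling_factorial (real N) (Suc m) = falling_factorial (real N) m * (real N - real m)"
    by (simp add: falling_factorial_def)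
  moreover have "real N - real m \<noteq> 0"
    using assms by simp
  ultimately show ?thesis
    by (simp add: power_falling_ratio_def)
qed

text \<open>
  The case \<open>d = 0\<close> restates the recursion of the ratio; each further case follows by taking the
  difference of the previous one at \<open>m + 1\<close> and \<open>m\<close>. In the case \<open>d = 0\<close> the truncated order \<open>d - 1\<close> comes
  with the coefficient \<open>0\<close>. The point of the recurrence is that its right-hand side has no
  negative coefficient, although differences are formed with alternating signs.
\<close>

lemma power_falling_ratio_difference_rec:
  assumes "m + Suc d \<le> N"
  shows "(real N - real m) * (forward_difference ^^ Suc d) (power_falling_ratio N) m
       = real m * (forward_difference ^^ d) (power_falling_ratio N) m
       + real d * (forward_difference ^^ (d - 1)) (power_falling_ratio N) (m + 2)"
  using assms
proof (induction d arbitrary: m)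
  case 0
  then show ?case
    using power_falling_ratio_Suc[of m N] by (simp add: forward_difference_def algebra_simps)
next
  case (Suc d)
  define a where "a d m = (forward_difference ^^ d) (power_falling_ratio N) m" for d m
  have step: "a (Suc e) n = a e (Suc n) - a e n" for e n
    unfolding a_def by (rule iterated_difference_Suc)
  have IH: "(real N - real n) * a (Suc d) n = real n * a d n + real d * a (d - 1) (n + 2)"
    if "n + Suc d \<le> N" for n
    using Suc.IH[OF that] unfolding a_def .
  have low: "real d * a (d - 1) (Suc m + 2) - real d * a (d - 1) (m + 2) = real d * a d (m + 2)"
  proof (cases d)
    case (Suc e)
    then show ?thesis
      using step[of e "m + 2"] by (simp flip: right_diff_distrib)
  qed simp
  have "(real N - real m) * a (Suc (Suc d)) m
      = (real N - real (Suc m)) * a (Suc d) (Suc m) - (real N - real m) * a (Suc d) m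
        + a (Suc d) (Suc m)"
    by (simp add: step algebra_simps)
  also have "\<dots> = real (Suc m) * a d (Suc m) - real m * a d m + a (Suc d) (Suc m)
                  + real d * a d (m + 2)"
    using IH[of "Suc m"] IH[of m] Suc.prems low by simp
  also have "\<dots> = real m * a (Suc d) m + real (Suc d) * a d (m + 2)"
    by (simp add: step algebra_simps)
  finally show ?case
    by (simp add: a_def)
qed

text \<open>
  For \<open>d \<ge> 2\<close> strictness comes from the second term of the recurrence, a difference of order \<open>d - 2\<close>
  taken at \<open>m + 2\<close>: this point is not \<open>0\<close>, so the exceptional pair \<open>d = 1\<close>, \<open>m = 0\<close> is never met.
  For \<open>d = 1\<close> only the term \<open>m h(m)\<close> remains, which vanishes exactly at \<open>m = 0\<close>.
\<close>

lemma power_falling_ratio_difference_sign: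
  assumes "m + d \<le> N"
  shows "(forward_difference ^^ d) (power_falling_ratio N) m \<ge> 0 \<and>
         (d \<noteq> 1 \<or> m \<noteq> 0 \<longrightarrow> (forward_difference ^^ d) (power_falling_ratio N) m > 0)"
  using assms
proof (induction d arbitrary: m rule: less_induct)
  case (less d)
  show ?case
  proof (cases d)
    case 0
    then show ?thesis
      using power_falling_ratio_pos[of m N] less.prems by simp
  next
    case (Suc e)
    let ?a = "\<lambda>d. (forward_difference ^^ d) (power_falling_ratio N)"
    have pos: "real N - real m > 0"
      using less.prems Suc by simp
    have rec: "(real N - real m) * ?a d m = real m * ?a e m + real e * ?a (e - 1) (m + 2)"
      using power_falling_ratio_difference_rec[of m e N] less.prems Suc by simp
    have e: "?a e m \<ge> 0"
      using less.IH[of e m] less.prems Suc by simp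
    have e1: "real e * ?a (e - 1) (m + 2) \<ge> 0" "e \<noteq> 0 \<Longrightarrow> real e * ?a (e - 1) (m + 2) > 0"
      using less.IH[of "e - 1" "m + 2"] less.prems Suc by (cases "e = 0"; simp)+
    have "(real N - real m) * ?a d m \<ge> 0"
      using rec e e1(1) by simp
    moreover have "(real N - real m) * ?a d m > 0" if "d \<noteq> 1 \<or> m \<noteq> 0"
    proof (cases "e = 0")
      case True
      then show ?thesis
        using rec that Suc power_falling_ratio_pos[of m N] less.prems by simp
    next
      case False
      then show ?thesis
        using rec e e1(2) by (simp add: add_nonneg_pos)
    qed
    ultimately show ?thesis
      using pos by (simp add: zero_le_mult_iff zero_less_mult_iff)
  qed
qed

text \<open>
  This is the factor of \<open>\<mu>(\<pi>, \<sigma>) \<mu>(\<pi>, \<tau>)\<close> in the centered Weingarten function, for a partition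
  \<open>\<pi>\<close> with \<open>n\<close> blocks.
\<close>

definition centered_coeff :: "nat \<Rightarrow> nat \<Rightarrow> nat \<Rightarrow> real" where
  "centered_coeff N d n = (\<Sum>i=0..d. real (d choose i) * (-1) ^ i *
     (inverse (real N ^ i) * (1 / falling_factorial (real N) (n - i))))"

lemma centered_coeff_eq_difference:
  assumes "d \<le> n" "n \<le> N"
  shows "real N ^ n * centered_coeff N d n
       = (forward_difference ^^ d) (power_falling_ratio N) (n - d)"
proof -
  have pow: "real N ^ n * inverse (real N ^ i) = real N ^ (n - i)" if "i \<le> d" for i
  proof (cases "N = 0")
    case True
    then show ?thesis using assms that by simp
  next
    case False
    then show ?thesis
      using assms that by (simp add: power_diff field_simps)
  qed
  have "real N ^ n * (real (d choose i) * (-1) ^ i *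
        (inverse (real N ^ i) * (1 / falling_factorial (real N) (n - i))))
      = real (d choose i) * (-1) ^ i * power_falling_ratio N (n - i)" if "i \<le> d" for i
  proof -
    have "real N ^ n * (real (d choose i) * (-1) ^ i *
        (inverse (real N ^ i) * (1 / falling_factorial (real N) (n - i))))
      = real (d choose i) * (-1) ^ i *
        ((real N ^ n * inverse (real N ^ i)) / falling_factorial (real N) (n - i))"
      by (simp only: mult_1_right times_divide_eq_right ac_simps)
    then show ?thesis
      by (simp only: pow[OF that] power_falling_ratio_def)
  qed
  then show ?thesis
    using assms(1)
    by (simp add: centered_coeff_def iterated_difference_binomial sum_distrib_left
        atLeast0AtMost)
qed

lemma centered_coeff_sign:
  assumes "d \<le> n" "n \<le> N"
  shows "centered_coeff N d n \<ge> 0" and "d \<noteq> 1 \<or> n \<noteq> 1 \<Longrightarrow> centered_coeff N d n > 0"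
proof -
  have pos: "real N ^ n > 0"
    using assms by (cases "N = 0") auto
  have "real N ^ n * centered_coeff N d n \<ge> 0 \<and>
        (d \<noteq> 1 \<or> n - d \<noteq> 0 \<longrightarrow> real N ^ n * centered_coeff N d n > 0)"
    using power_falling_ratio_difference_sign[of "n - d" d N] assms
    by (simp add: centered_coeff_eq_difference)
  then show "centered_coeff N d n \<ge> 0" and "d \<noteq> 1 \<or> n \<noteq> 1 \<Longrightarrow> centered_coeff N d n > 0"
    using pos assms by (auto simp: zero_le_mult_iff zero_less_mult_iff)
qed

lemma centered_coeff_1_1: "N \<ge> 1 \<Longrightarrow> centered_coeff N 1 1 = 0"
  by (simp add: centered_coeff_def falling_factorial_def divide_inverse)

section \<open>Partitions and the sign of the Moebius function\<close>

lemma partition_on_card_le: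
  assumes "finite A" "partition_on A P"
  shows "card P \<le> card A"
proof -
  have fin: "finite p" if "p \<in> P" for p
    using assms that partition_onD1 by (metis Sup_upper finite_subset)
  have "card P = (\<Sum>p\<in>P. 1)"
    by simp
  also have "\<dots> \<le> (\<Sum>p\<in>P. card p)"
  proof (rule sum_mono)
    fix p assume "p \<in> P"
    then show "1 \<le> card p"
      using fin partition_onD3[OF assms(2)] by (metis One_nat_def Suc_leI card_gt_0_iff)
  qed
  also have "\<dots> = card A"
    using product_partition[OF assms(2) fin] by simp
  finally show ?thesis .
qed

lemma refines_singletons:
  assumes "partition_on A P"
  shows "refines A ((\<lambda>x. {x}) ` A) P"
  using assms partition_on_singletons[of A] unfolding refines_def partition_on_def by blast

lemma refines_singleton_block:
  assumes "refines A P Q" "{x} \<in> Q"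
  shows "{x} \<in> P"
proof -
  have P: "partition_on {x} {p \<in> P. p \<subseteq> {x}}"
    using refines_obtains_subset[OF assms] .
  then obtain p where "p \<in> P" "p \<subseteq> {x}"
    using partition_onD1[OF P] by blast
  moreover have "p \<noteq> {}"
    using assms(1) \<open>p \<in> P\<close> unfolding refines_def partition_on_def by blast
  ultimately show ?thesis
    by (metis subset_singletonD)
qed

lemma card_singleton_points_le:
  assumes "refines {1..k} P Q"
  shows "card (singleton_points k Q) \<le> card P"
proof -
  have "(\<lambda>x. {x}) ` singleton_points k Q \<subseteq> P"
    using refines_singleton_block[OF assms] by (auto simp: singleton_points_def)
  moreover have "finite P"
    using assms finite_elements[of "{1..k}" P] unfolding refines_def by simp
  ultimately have "card ((\<lambda>x. {x}) ` singleton_points k Q) \<le> card P"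
    by (simp add: card_mono)
  then show ?thesis
    by (simp add: card_image)
qed

lemma refines_card_eq_sum:
  assumes "finite A" "refines A P Q"
  shows "card P = (\<Sum>B\<in>Q. card {p \<in> P. p \<subseteq> B})"
proof -
  have P: "partition_on A P" and Q: "partition_on A Q"
    using assms(2) unfolding refines_def by auto
  have fin: "finite P" "finite Q"
    using finite_elements[OF assms(1)] P Q by auto
  have "{p \<in> P. p \<subseteq> B} \<inter> {p \<in> P. p \<subseteq> C} = {}" if "B \<in> Q" "C \<in> Q" "B \<noteq> C" for B C
  proof -
    have "B \<inter> C = {}"
      using partition_onD2[OF Q] that by (auto dest: disjointD)
    then show ?thesis
      using partition_onD3[OF P] by (auto simp: disjoint_iff) (metis all_not_in_conv subsetD)
  qed
  moreover have "P = (\<Union>B\<in>Q. {p \<in> P. p \<subseteq> B})"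
    using assms(2) unfolding refines_def by blast
  ultimately show ?thesis
    using card_UN_disjoint[of Q "\<lambda>B. {p \<in> P. p \<subseteq> B}"] fin by simp
qed

text \<open>
  A block of \<open>Q\<close> that splits into \<open>l\<close> blocks of \<open>P\<close> contributes the sign \<open>(-1)\<^bsup>l - 1\<^esup>\<close>, and
  the exponents \<open>l - 1\<close> add up to \<open>card P - card Q\<close>; the sum \<open>card P + card Q\<close> has the same
  parity and avoids subtraction on the natural numbers.
\<close>

lemma partition_moebius_sign:
  assumes "finite A" "refines A P Q"
  shows "(-1) ^ (card P + card Q) * partition_moebius P Q > 0"
proof -
  define l where "l B = card {p \<in> P. p \<subseteq> B}" for B
  have l_pos: "l B > 0" if "B \<in> Q" for B
  proof -
    have "partition_on B {p \<in> P. p \<subseteq> B}"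
      using refines_obtains_subset[OF assms(2) that] .
    moreover have "B \<noteq> {}"
      using assms(2) that unfolding refines_def partition_on_def by blast
    moreover have "finite P"
      using assms finite_elements unfolding refines_def by blast
    ultimately have "{p \<in> P. p \<subseteq> B} \<noteq> {}" "finite {p \<in> P. p \<subseteq> B}"
      by (auto dest: partition_onD1)
    then show ?thesis
      unfolding l_def by (simp add: card_gt_0_iff)
  qed
  have "card P + card Q = (\<Sum>B\<in>Q. l B + 1)"
    unfolding l_def sum.distrib using refines_card_eq_sum[OF assms] by simp
  then have "(-1) ^ (card P + card Q) = (\<Prod>B\<in>Q. (-1) ^ (l B + 1) :: real)"
    by (simp only: power_sum)
  then have "(-1) ^ (card P + card Q) * partition_moebius P Q
      = (\<Prod>B\<in>Q. (-1) ^ (l B + 1) * ((-1) ^ (l B - 1) * fact (l B - 1)))"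
    by (simp only: partition_moebius_def Let_def l_def prod.distrib)
  also have "\<dots> = (\<Prod>B\<in>Q. fact (l B - 1))"
  proof (rule prod.cong)
    fix B assume "B \<in> Q"
    then obtain n where "l B = Suc n"
      using l_pos gr0_implies_Suc by blast
    then show "(-1) ^ (l B + 1) * ((-1) ^ (l B - 1) * fact (l B - 1)) = (fact (l B - 1) :: real)"
      by (simp flip: power_add mult.assoc add: mult_2[symmetric])
  qed simp
  also have "\<dots> > (0 :: real)"
    by (rule prod_pos) simp
  finally show ?thesis .
qed

section \<open>The sign of the centered Weingarten function\<close>

lemma centered_Wg_eq_sum_coeff:
  "centered_Wg k \<sigma> \<tau> N =
     (let L = partition_lattice k in
      \<Sum>\<pi> | \<pi> \<in> carrier L \<and> \<pi> \<sqsubseteq>\<^bsub>L\<^esub> \<sigma> \<sqinter>\<^bsub>L\<^esub> \<tau>.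
        partition_moebius \<pi> \<sigma> * partition_moebius \<pi> \<tau> *
        centered_coeff N (card (singleton_points k (\<sigma> \<squnion>\<^bsub>L\<^esub> \<tau>))) (card \<pi>))"
  unfolding centered_Wg_def centered_coeff_def Let_def sum_distrib_left
  by (subst sum.swap) (simp add: ac_simps)

theorem corollary3p7:
  fixes k N :: nat and \<sigma> \<tau> :: "nat set set"
  assumes "k \<le> N"
    and "\<sigma> \<in> carrier (partition_lattice k)" and "\<tau> \<in> carrier (partition_lattice k)"
  shows "(k \<noteq> 1 \<longrightarrow> sgn (centered_Wg k \<sigma> \<tau> N) = (-1) ^ (card \<sigma> + card \<tau>)) \<and>
         (k = 1 \<longrightarrow> centered_Wg k \<sigma> \<tau> N = 0)"
proof -
  let ?L = "partition_lattice k" and ?A = "{1..k}"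
  let ?meet = "\<sigma> \<sqinter>\<^bsub>?L\<^esub> \<tau>" and ?join = "\<sigma> \<squnion>\<^bsub>?L\<^esub> \<tau>"
  let ?s = "(-1) ^ (card \<sigma> + card \<tau>) :: real"
  interpret lattice ?L
    by (rule lattice_partition_lattice)
  define d where "d = card (singleton_points k ?join)"
  define S where "S = {\<pi>. partition_on ?A \<pi> \<and> refines ?A \<pi> ?meet}"
  define t where "t \<pi> = partition_moebius \<pi> \<sigma> * partition_moebius \<pi> \<tau> *
                        centered_coeff N d (card \<pi>)" for \<pi>
  have Wg: "centered_Wg k \<sigma> \<tau> N = (\<Sum>\<pi>\<in>S. t \<pi>)"
    by (simp add: centered_Wg_eq_sum_coeff Let_def S_def t_def d_def)
  have finS: "finite S"
    using finitely_many_partition_on[of ?A] unfolding S_def by (rule rev_finite_subset) auto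
  have meet: "partition_on ?A ?meet" "refines ?A ?meet \<sigma>" "refines ?A ?meet \<tau>"
    using meet_closed[OF assms(2,3)] meet_left[OF assms(2,3)] meet_right[OF assms(2,3)]
    by simp_all
  have join: "partition_on ?A ?join" "refines ?A \<sigma> ?join"
    using join_closed[OF assms(2,3)] join_left[OF assms(2,3)] by simp_all
  have below: "refines ?A \<pi> \<sigma>" "refines ?A \<pi> \<tau>" "d \<le> card \<pi>" "card \<pi> \<le> k" if "\<pi> \<in> S" for \<pi>
  proof -
    have \<pi>: "partition_on ?A \<pi>" "refines ?A \<pi> ?meet"
      using that by (simp_all add: S_def)
    show \<sigma>: "refines ?A \<pi> \<sigma>" and "refines ?A \<pi> \<tau>"
      using refines_trans[OF \<pi>(2)] meet by blast+
    show "d \<le> card \<pi>"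
      unfolding d_def using card_singleton_points_le refines_trans[OF \<sigma> join(2)] .
    show "card \<pi> \<le> k"
      using partition_on_card_le[OF _ \<pi>(1)] by simp
  qed
  have moebius: "?s * (partition_moebius \<pi> \<sigma> * partition_moebius \<pi> \<tau>) > 0" if "\<pi> \<in> S" for \<pi>
  proof -
    have "0 < ((-1) ^ (card \<pi> + card \<sigma>) * partition_moebius \<pi> \<sigma>) *
              ((-1) ^ (card \<pi> + card \<tau>) * partition_moebius \<pi> \<tau>)"
      using below(1,2)[OF that] by (intro mult_pos_pos partition_moebius_sign[of ?A]) simp_all
    also have "\<dots> = ?s * (partition_moebius \<pi> \<sigma> * partition_moebius \<pi> \<tau>)"
      by (simp add: power_add mult.assoc mult.left_commute flip: power_mult_distrib)
    finally show ?thesis .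
  qed
  have s_t: "?s * t \<pi> = (?s * (partition_moebius \<pi> \<sigma> * partition_moebius \<pi> \<tau>)) *
                        centered_coeff N d (card \<pi>)" for \<pi>
    by (simp add: t_def mult.assoc)
  have nonneg: "?s * t \<pi> \<ge> 0" if "\<pi> \<in> S" for \<pi>
    unfolding s_t
  proof (rule mult_nonneg_nonneg)
    show "?s * (partition_moebius \<pi> \<sigma> * partition_moebius \<pi> \<tau>) \<ge> 0"
      using moebius[OF that] by (rule less_imp_le)
    show "centered_coeff N d (card \<pi>) \<ge> 0"
      using below(3,4)[OF that] assms(1) by (intro centered_coeff_sign(1)) simp_all
  qed
  show ?thesis
  proof (intro conjI impI)
    assume k: "k \<noteq> 1"
    let ?finest = "(\<lambda>x. {x}) ` ?A"
    have finest: "?finest \<in> S"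
      unfolding S_def using refines_singletons[OF meet(1)] partition_on_singletons by blast
    have "card ?finest = k"
      by (simp add: card_image)
    then have "centered_coeff N d (card ?finest) > 0"
      using centered_coeff_sign(2)[of d k N] below(3)[OF finest] assms(1) k by simp
    then have "?s * t ?finest > 0"
      unfolding s_t using moebius[OF finest] by (rule mult_pos_pos[rotated])
    then have "(\<Sum>\<pi>\<in>S. ?s * t \<pi>) > 0"
      by (rule sum_pos2[OF finS finest]) (rule nonneg)
    then have "?s * centered_Wg k \<sigma> \<tau> N > 0"
      by (simp add: Wg sum_distrib_left)
    then show "sgn (centered_Wg k \<sigma> \<tau> N) = ?s"
      by (cases "even (card \<sigma> + card \<tau>)") simp_all
  next
    assume k: "k = 1"
    have unique: "P = {{1}}" if "partition_on ?A P" for P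
    proof -
      have P: "\<Union>P = {1}" "{} \<notin> P"
        using that k by (simp_all add: partition_on_def)
      then have "p = {1}" if "p \<in> P" for p
        using that by (metis Sup_upper subset_singletonD)
      moreover have "P \<noteq> {}"
        using P(1) by auto
      ultimately show ?thesis
        by blast
    qed
    have "d = 1"
      unfolding d_def unique[OF join(1)] using k by (simp add: singleton_points_def)
    moreover have "card \<pi> = 1" if "\<pi> \<in> S" for \<pi>
      using that unique[of \<pi>] by (simp add: S_def)
    ultimately have "t \<pi> = 0" if "\<pi> \<in> S" for \<pi>
      unfolding t_def using centered_coeff_1_1[of N] assms(1) k that by simp
    then show "centered_Wg k \<sigma> \<tau> N = 0"
      by (simp add: Wg)
  qed
qed

end
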